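(* Let $(G,\pi,P)$ be an online graph with predictions, where $G$ is a finite simple graph. If \textsc{FirstFitPredictions} uses $x(G)$ distinct colors on $(G,\pi,P)$ (the algorithm having no knowledge of $\chi(G)$), then $x(G)\le \eta(G)+\chi(G)$.
   Context: An online graph with predictions $(G,\pi,P)$ consists of a graph $G=(V,E)$, an ordering $\pi=v_1,\dots,v_n$ of $V$ in which vertices are revealed one by one (with their adjacencies to previously revealed vertices), and a prediction map $P:V\to\mathcal{U}$, where $\mathcal{U}$ is the (infinite) universe of colors; $P(v)$ is revealed together with $v$. Colors must be assigned irrevocably upon arrival and the coloring must be proper. $\chi(G)$ is the chromatic number. Let $\mathcal{O}(G)$ be the set of proper colorings $O:V\to\mathcal{U}$ of $G$ using exactly $\chi(G)$ colors; the prediction error is $\eta(G)=\min_{O\in\mathcal{O}(G)}|\{v\in V: P(v)\neq O(v)\}|$. Algorithm \textsc{FirstFitPredictions}: for each predicted color $c$ there is an associated palette $C(c)=\{c^0,c^1,c^2,\dots\}$ ordered by superscript, with the palettes of distinct predicted colors pairwise disjoint; when a vertex $v$ with $P(v)=c$ arrives, it receives the color of smallest superscript in $C(c)$ that is not assigned to any previously revealed neighbor of $v$. (Equivalently, it runs \textsc{FirstFit} — assign the smallest color not used by an earlier neighbor — separately on each subgraph induced by the vertices sharing the same prediction, with disjoint palettes.) *)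

theory Defs
  imports "Graph_Theory.Pair_Digraph" "HOL-Library.Disjoint_Sets"
begin

text \<open>Finite simple graphs are the symmetric loop-free finite digraphs \<open>pair_graph\<close>: an
  undirected edge \<open>{u, v}\<close> is the pair of arcs \<open>(u, v)\<close> and \<open>(v, u)\<close>.\<close>

definition proper_coloring :: "'a pair_pre_digraph \<Rightarrow> ('a \<Rightarrow> 'c) \<Rightarrow> bool" where
  "proper_coloring G f \<longleftrightarrow> (\<forall>(u, v) \<in> parcs G. f u \<noteq> f v)"

definition num_colors :: "'a pair_pre_digraph \<Rightarrow> ('a \<Rightarrow> 'c) \<Rightarrow> nat" where
  "num_colors G f = card (f ` pverts G)"

definition chromatic_number :: "'a pair_pre_digraph \<Rightarrow> nat" where
  "chromatic_number G = (LEAST k. \<exists>f :: 'a \<Rightarrow> nat. proper_coloring G f \<and> num_colors G f = k)"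

definition optimal_colorings :: "'a pair_pre_digraph \<Rightarrow> ('a \<Rightarrow> 'c) set" where
  "optimal_colorings G = {f. proper_coloring G f \<and> num_colors G f = chromatic_number G}"

text \<open>The values minimised over are at most \<open>card (pverts G)\<close>, so the set is finite;
  it is nonempty if the type \<open>'c\<close> of colors is infinite.\<close>

definition prediction_error :: "'a pair_pre_digraph \<Rightarrow> ('a \<Rightarrow> 'c) \<Rightarrow> nat" where
  "prediction_error G P =
     Min ((\<lambda>f. card {v \<in> pverts G. P v \<noteq> f v}) ` optimal_colorings G)"

text \<open>The state of the online algorithm is a partial coloring \<open>s\<close> whose domain is the set of
  vertices revealed so far. \<open>C c i\<close> is the color with superscript \<open>i\<close> in the palette of the
  predicted color \<open>c\<close>.\<close>

definition ffp_choice ::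
  "'a pair_pre_digraph \<Rightarrow> ('a \<Rightarrow> 'c) \<Rightarrow> ('c \<Rightarrow> nat \<Rightarrow> 'c) \<Rightarrow> ('a \<rightharpoonup> 'c) \<Rightarrow> 'a \<Rightarrow> 'c" where
  "ffp_choice G P C s v =
     C (P v) (LEAST i. \<forall>u. (u, v) \<in> parcs G \<longrightarrow> s u \<noteq> Some (C (P v) i))"

primrec ffp_run ::
  "'a pair_pre_digraph \<Rightarrow> ('a \<Rightarrow> 'c) \<Rightarrow> ('c \<Rightarrow> nat \<Rightarrow> 'c) \<Rightarrow> ('a \<rightharpoonup> 'c) \<Rightarrow> 'a list \<Rightarrow> ('a \<rightharpoonup> 'c)" where
  "ffp_run G P C s [] = s"
| "ffp_run G P C s (v # vs) = ffp_run G P C (s(v \<mapsto> ffp_choice G P C s v)) vs"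

definition first_fit_predictions ::
  "'a pair_pre_digraph \<Rightarrow> 'a list \<Rightarrow> ('a \<Rightarrow> 'c) \<Rightarrow> ('c \<Rightarrow> nat \<Rightarrow> 'c) \<Rightarrow> ('a \<rightharpoonup> 'c)" where
  "first_fit_predictions G \<pi> P C = ffp_run G P C Map.empty \<pi>"

end

theory Submission
  imports Defs
begin

text \<open>Fix an optimal coloring \<open>f\<close> that attains the prediction error, and call a vertex wrong if
  \<open>P v \<noteq> f v\<close>. At most \<open>\<eta>(G)\<close> of the colors used contain a wrong vertex. For each predicted color
  \<open>c\<close>, at most one used color of the palette of \<open>c\<close> contains no wrong vertex: given two, a vertex of
  the one with larger superscript has a neighbor in the other by the first-fit rule, yet \<open>f\<close> sends
  both to \<open>c\<close>. Since such a \<open>c\<close> is a color used by \<open>f\<close>, there are at most \<open>\<chi>(G)\<close> of these colors.\<close>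

text \<open>The invariant forgets the order of arrival: blocking neighbors are sought in the current
  state rather than among earlier vertices. It therefore survives later extensions and can be
  applied to the final coloring.\<close>

definition first_fit_state ::
  "'a pair_pre_digraph \<Rightarrow> ('a \<Rightarrow> 'c) \<Rightarrow> ('c \<Rightarrow> nat \<Rightarrow> 'c) \<Rightarrow> ('a \<rightharpoonup> 'c) \<Rightarrow> bool" where
  "first_fit_state G P C s \<longleftrightarrow>
     (\<forall>v x. s v = Some x \<longrightarrow>
        (\<exists>i. x = C (P v) i \<and> (\<forall>j<i. \<exists>u. (u, v) \<in> parcs G \<and> s u = Some (C (P v) j))))"

lemma first_fit_state_update:
  assumes "first_fit_state G P C s" "v \<notin> dom s"
  shows "first_fit_state G P C (s(v \<mapsto> ffp_choice G P C s v))"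
  unfolding first_fit_state_def
proof (intro allI impI)
  let ?s = "s(v \<mapsto> ffp_choice G P C s v)"
  \<comment> \<open>As \<open>v\<close> is fresh, the update overwrites no color, so a neighbor that
    blocks a superscript keeps blocking it.\<close>
  have ext: "?s u = Some y" if "s u = Some y" for u y
    using that assms(2) by auto
  fix w x assume w: "?s w = Some x"
  show "\<exists>i. x = C (P w) i \<and> (\<forall>j<i. \<exists>u. (u, w) \<in> parcs G \<and> ?s u = Some (C (P w) j))"
  proof (cases "w = v")
    case True
    define i where "i = (LEAST i. \<forall>u. (u, v) \<in> parcs G \<longrightarrow> s u \<noteq> Some (C (P v) i))"
    \<comment> \<open>A superscript below the \<open>LEAST\<close> one is not free, so some neighbor
      already carries its color.\<close>
    have "\<exists>u. (u, v) \<in> parcs G \<and> s u = Some (C (P v) j)" if "j < i" for j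
      using not_less_Least[OF that[unfolded i_def]] by blast
    moreover have "x = C (P v) i"
      using w True by (simp add: ffp_choice_def i_def)
    ultimately show ?thesis
      using True ext by blast
  next
    case False
    then have "s w = Some x"
      using w by simp
    then show ?thesis
      using assms(1) ext unfolding first_fit_state_def by meson
  qed
qed

lemma first_fit_state_ffp_run:
  assumes "first_fit_state G P C s" "distinct vs" "set vs \<inter> dom s = {}"
  shows "first_fit_state G P C (ffp_run G P C s vs)"
  using assms
proof (induction vs arbitrary: s)
  case (Cons v vs)
  then have "first_fit_state G P C (s(v \<mapsto> ffp_choice G P C s v))"
    by (intro first_fit_state_update) auto
  moreover have "set vs \<inter> dom (s(v \<mapsto> ffp_choice G P C s v)) = {}"
    using Cons.prems by auto
  moreover have "distinct vs"
    using Cons.prems(2) by simp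
  ultimately show ?case
    unfolding ffp_run.simps by (intro Cons.IH)
qed simp

lemma dom_ffp_run: "dom (ffp_run G P C s vs) = dom s \<union> set vs"
  by (induction vs arbitrary: s) auto

text \<open>\<open>chromatic_number\<close> is defined through colorings by natural numbers.
  Composing an optimal one with an injection of \<open>nat\<close> into the infinite type
  \<open>'c\<close> preserves properness and the number of colors.\<close>

lemma optimal_colorings_nonempty:
  assumes "infinite (UNIV :: 'c set)" "pair_graph G"
  shows "(optimal_colorings G :: ('a \<Rightarrow> 'c) set) \<noteq> {}"
proof -
  interpret pair_graph G by fact
  \<comment> \<open>Giving all vertices different colors is proper because there are no loops, so
    the \<open>LEAST\<close> in \<open>chromatic_number\<close> is attained.\<close>
  obtain e :: "'a \<Rightarrow> nat" where e: "inj_on e (pverts G)"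
    using finite_imp_inj_to_nat_seg[OF finite_verts] by auto
  have "proper_coloring G e"
    unfolding proper_coloring_def
  proof safe
    fix u v assume "(u, v) \<in> parcs G" "e u = e v"
    then show False
      using inj_onD[OF e] in_arcsD1 in_arcsD2 no_loops' by metis
  qed
  then have "\<exists>k. \<exists>f :: 'a \<Rightarrow> nat. proper_coloring G f \<and> num_colors G f = k"
    by blast
  from LeastI_ex[OF this] obtain f :: "'a \<Rightarrow> nat"
    where f: "proper_coloring G f" "num_colors G f = chromatic_number G"
    unfolding chromatic_number_def by blast
  obtain g :: "nat \<Rightarrow> 'c" where g: "inj g"
    using infinite_countable_subset[OF assms(1)] by blast
  have "proper_coloring G (g \<circ> f)"
    using f(1) g unfolding proper_coloring_def by (auto dest: injD)
  moreover have "num_colors G (g \<circ> f) = chromatic_number G"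
    using f(2) g unfolding num_colors_def image_comp[symmetric]
    by (metis card_image inj_on_subset subset_UNIV)
  ultimately show ?thesis
    unfolding optimal_colorings_def by blast
qed

text \<open>A \<open>Min\<close> is attained on a finite nonempty set: the errors are bounded by the
  number of vertices, and an optimal coloring exists.\<close>

lemma prediction_error_attained:
  fixes P :: "'a \<Rightarrow> 'c"
  assumes "infinite (UNIV :: 'c set)" "pair_graph G"
  obtains f where "f \<in> optimal_colorings G"
    "card {v \<in> pverts G. P v \<noteq> f v} = prediction_error G P"
proof -
  interpret pair_graph G by fact
  let ?S = "(\<lambda>f. card {v \<in> pverts G. P v \<noteq> f v}) ` optimal_colorings G"
  have "?S \<subseteq> {..card (pverts G)}"
    by (auto intro!: card_mono)
  then have "finite ?S"
    by (rule finite_subset) simp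
  then have "prediction_error G P \<in> ?S"
    unfolding prediction_error_def using optimal_colorings_nonempty[OF assms] by (intro Min_in) auto
  then show ?thesis
    using that by auto
qed

lemma card_ran_first_fit_state_le:
  assumes "finite (pverts G)" "dom s = pverts G"
    and ff: "first_fit_state G P C s"
    and disj: "disjoint_family_on (\<lambda>c. range (C c)) (P ` pverts G)"
    and proper: "proper_coloring G f"
  shows "card (ran s) \<le> card {v \<in> pverts G. P v \<noteq> f v} + num_colors G f"
proof -
  \<comment> \<open>\<open>W\<close> consists of the wrong vertices, \<open>B\<close> of the colors
    given to some wrong vertex, and \<open>Q\<close> of the other used colors. Below,
    \<open>r\<close> picks one vertex for each color in \<open>Q\<close>.\<close>
  define W where "W = {v \<in> pverts G. P v \<noteq> f v}"
  define B where "B = (the \<circ> s) ` W"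
  define Q where "Q = ran s - B"
  have "\<exists>v. s v = Some x" if "x \<in> Q" for x
    using that by (auto simp: Q_def ran_def)
  then obtain r where r: "s (r x) = Some x" if "x \<in> Q" for x
    by metis
  have vert: "v \<in> pverts G" if "s v = Some x" for v x
    using that assms(2) by auto
  have right: "f v = P v" if "x \<in> Q" "s v = Some x" for v x
    using that vert[OF that(2)] unfolding Q_def B_def W_def by force
  \<comment> \<open>The first-fit contradiction, with the superscripts ordered so that it can be
    applied in both directions.\<close>
  have no_clash: False
    if clash: "C c i \<in> Q" "C c j \<in> Q" "P (r (C c j)) = c" "i < j"
      "\<forall>k<j. \<exists>u. (u, r (C c j)) \<in> parcs G \<and> s u = Some (C c k)" for c i j
  proof -
    let ?v = "r (C c j)"
    obtain u where u: "(u, ?v) \<in> parcs G" "s u = Some (C c i)"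
      using clash(4,5) by blast
    \<comment> \<open>The invariant places the color of \<open>u\<close> in the palette of
      \<open>P u\<close>. Since it also lies in that of \<open>c\<close>, disjointness of the
      palettes gives \<open>P u = c\<close>.\<close>
    have "C c i \<in> range (C (P u))"
      using ff u(2) unfolding first_fit_state_def by blast
    moreover have "P u \<in> P ` pverts G" "c \<in> P ` pverts G"
      using imageI[OF vert[OF u(2)], of P] imageI[OF vert[OF r[OF clash(2)]], of P]
      unfolding clash(3) .
    ultimately have "P u = c"
      using disjoint_family_onD[OF disj, of "P u" c] by blast
    then have "f u = f ?v"
      using right[OF clash(1) u(2)] right[OF clash(2) r[OF clash(2)]] clash(3) by simp
    then show False
      using proper u(1) unfolding proper_coloring_def by blast
  qed
  \<comment> \<open>Injectivity says that each palette contributes at most one color to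
    \<open>Q\<close>.\<close>
  have "inj_on (P \<circ> r) Q"
  proof (rule inj_onI)
    fix x y assume xy: "x \<in> Q" "y \<in> Q" "(P \<circ> r) x = (P \<circ> r) y"
    obtain i where i: "x = C (P (r x)) i"
      "\<forall>k<i. \<exists>u. (u, r x) \<in> parcs G \<and> s u = Some (C (P (r x)) k)"
      using ff r[OF xy(1)] unfolding first_fit_state_def by blast
    obtain j where j: "y = C (P (r y)) j"
      "\<forall>k<j. \<exists>u. (u, r y) \<in> parcs G \<and> s u = Some (C (P (r y)) k)"
      using ff r[OF xy(2)] unfolding first_fit_state_def by blast
    have eq: "P (r y) = P (r x)"
      using xy(3) by simp
    have x: "C (P (r x)) i = x"
      using i(1) by (rule sym)
    have y: "C (P (r x)) j = y"
      using j(1)[unfolded eq] by (rule sym)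
    have "\<not> i < j" "\<not> j < i"
      using no_clash[of "P (r x)" i j, unfolded x y] no_clash[of "P (r x)" j i, unfolded x y]
        i(2) j(2) xy(1,2) eq by auto
    then show "x = y"
      using x y by (metis nat_neq_iff)
  qed
  \<comment> \<open>The chosen vertices are right, so their predictions are values of
    \<open>f\<close>; this bounds \<open>card Q\<close> by \<open>num_colors G f\<close>.\<close>
  moreover have "(P \<circ> r) ` Q \<subseteq> f ` pverts G"
  proof (rule image_subsetI)
    fix x assume "x \<in> Q"
    then show "(P \<circ> r) x \<in> f ` pverts G"
      using right[OF _ r] vert[OF r] by (metis comp_apply imageI)
  qed
  ultimately have "card Q \<le> num_colors G f"
    unfolding num_colors_def using assms(1) by (meson card_inj_on_le finite_imageI)
  moreover have "card B \<le> card W"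
    unfolding B_def W_def using assms(1) by (intro card_image_le) simp
  moreover have "card (ran s) \<le> card (B \<union> Q)"
    using assms(1,2) unfolding Q_def B_def W_def
    by (intro card_mono) (auto simp: finite_ran)
  ultimately show ?thesis
    using card_Un_le[of B Q] unfolding W_def by linarith
qed

theorem theorem2:
  fixes G :: "'a pair_pre_digraph" and \<pi> :: "'a list"
    and P :: "'a \<Rightarrow> 'c" and C :: "'c \<Rightarrow> nat \<Rightarrow> 'c"
  assumes "infinite (UNIV :: 'c set)"
    and "pair_graph G"
    and "distinct \<pi>" and "set \<pi> = pverts G"
    and "\<And>c. c \<in> P ` pverts G \<Longrightarrow> inj (C c)"
    and "disjoint_family_on (\<lambda>c. range (C c)) (P ` pverts G)"
  shows "card (ran (first_fit_predictions G \<pi> P C)) \<le> prediction_error G P + chromatic_number G"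
proof -
  obtain f where f: "f \<in> optimal_colorings G"
    "card {v \<in> pverts G. P v \<noteq> f v} = prediction_error G P"
    using prediction_error_attained[OF assms(1,2)] .
  have "proper_coloring G f" and opt: "num_colors G f = chromatic_number G"
    using f(1) by (simp_all add: optimal_colorings_def)
  \<comment> \<open>The empty state satisfies the invariant vacuously, and distinctness of
    \<open>\<pi>\<close> makes every arriving vertex fresh.\<close>
  moreover have "first_fit_state G P C (first_fit_predictions G \<pi> P C)"
    unfolding first_fit_predictions_def using assms(3)
    by (intro first_fit_state_ffp_run) (auto simp: first_fit_state_def)
  moreover have "dom (first_fit_predictions G \<pi> P C) = pverts G"
    by (simp add: first_fit_predictions_def dom_ffp_run assms(4))
  moreover have "finite (pverts G)"
    unfolding assms(4)[symmetric] by (rule List.finite_set)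
  ultimately show ?thesis
    unfolding f(2)[symmetric] opt[symmetric] using assms(6)
    by (intro card_ran_first_fit_state_le)
qed

end
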